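(* Suppose $s$, $l$, and $a$ are nonnegative integers such that $l \geq 2$, $a > s+2$, and $(a-s-1)$ divides $(l+s+1)$. Let $q=(l+s+1)/(a-s-1)$. If $b$ is an integer with $b \geq a$ and $$b \geq (l+s+1)^s\left(\binom{l+s+1}{l+1} + \binom{l+s+1}{l} q\right),$$ then $\tau_s(a,b) \geq l$.
   Context: All graphs are finite and simple. For graphs $G,H$ on disjoint vertex sets, the join $G \vee H$ is the graph consisting of $G$, $H$, and all edges joining a vertex of $G$ to a vertex of $H$; $K_n$ is the complete graph on $n$ vertices, and $K_0 \vee G$ is understood as $G$. $K_{a,b}$ is the complete bipartite graph with partite sets of sizes $a$ and $b$. $\chi$ denotes chromatic number and $\chi_\ell$ list chromatic number. For a nonnegative integer $s$ and positive integers $a \le b$, $\tau_s(a,b)$ denotes the smallest nonnegative integer $n$ such that $\chi_\ell(K_n \vee K_{a,b}) - \chi(K_n \vee K_{a,b}) \leq s$. *)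

theory Defs
  imports Main
begin

record 'a ugraph =
  verts :: "'a set"
  edges :: "'a set set"

definition simple_graph :: "'a ugraph \<Rightarrow> bool" where
  "simple_graph G \<longleftrightarrow> finite (verts G) \<and> (\<forall>e \<in> edges G. e \<subseteq> verts G \<and> card e = 2)"

definition complete_graph :: "nat \<Rightarrow> nat ugraph" where
  "complete_graph n =
     \<lparr>verts = {..<n}, edges = {{u, v} | u v. u < n \<and> v < n \<and> u \<noteq> v}\<rparr>"

definition complete_bipartite :: "nat \<Rightarrow> nat \<Rightarrow> (nat + nat) ugraph" where
  "complete_bipartite a b =
     \<lparr>verts = {..<a} <+> {..<b}, edges = {{Inl u, Inr v} | u v. u < a \<and> v < b}\<rparr>"

text \<open>Disjointness of the two vertex sets is realised by the sum type.\<close>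

definition join :: "'a ugraph \<Rightarrow> 'b ugraph \<Rightarrow> ('a + 'b) ugraph" where
  "join G H =
     \<lparr>verts = verts G <+> verts H,
      edges = (image Inl) ` edges G \<union> (image Inr) ` edges H
        \<union> {{Inl u, Inr v} | u v. u \<in> verts G \<and> v \<in> verts H}\<rparr>"

lemma simple_graph_complete_graph: "simple_graph (complete_graph n)"
  by (auto simp: simple_graph_def complete_graph_def)

lemma simple_graph_complete_bipartite: "simple_graph (complete_bipartite a b)"
  by (auto simp: simple_graph_def complete_bipartite_def)

lemma simple_graph_join:
  assumes "simple_graph G" "simple_graph H"
  shows "simple_graph (join G H)"
  using assms by (auto simp: simple_graph_def join_def card_image)

definition proper_colouring :: "'a ugraph \<Rightarrow> ('a \<Rightarrow> nat) \<Rightarrow> bool" where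
  "proper_colouring G c \<longleftrightarrow> (\<forall>u v. {u, v} \<in> edges G \<longrightarrow> c u \<noteq> c v)"

definition colourable :: "'a ugraph \<Rightarrow> nat \<Rightarrow> bool" where
  "colourable G k \<longleftrightarrow> (\<exists>c. proper_colouring G c \<and> c ` verts G \<subseteq> {..<k})"

definition chromatic_number :: "'a ugraph \<Rightarrow> nat" where
  "chromatic_number G = (LEAST k. colourable G k)"

text \<open>Natural numbers as colours are no restriction: only finitely many colours occur in the
  lists of a finite graph.\<close>

definition choosable :: "'a ugraph \<Rightarrow> nat \<Rightarrow> bool" where
  "choosable G k \<longleftrightarrow>
     (\<forall>L :: 'a \<Rightarrow> nat set. (\<forall>v \<in> verts G. finite (L v) \<and> card (L v) = k) \<longrightarrow>
        (\<exists>c. proper_colouring G c \<and> (\<forall>v \<in> verts G. c v \<in> L v)))"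

definition list_chromatic_number :: "'a ugraph \<Rightarrow> nat" where
  "list_chromatic_number G = (LEAST k. choosable G k)"

text \<open>The difference is taken in the integers, so no truncation is involved.\<close>

definition tau :: "nat \<Rightarrow> nat \<Rightarrow> nat \<Rightarrow> nat" where
  "tau s a b =
     (LEAST n. int (list_chromatic_number (join (complete_graph n) (complete_bipartite a b)))
               - int (chromatic_number (join (complete_graph n) (complete_bipartite a b)))
             \<le> int s)"

end

theory Submission imports Defs "HOL-Library.FuncSet"
begin

text \<open>
  Let \<open>k = l + s + 1\<close> and \<open>m = a - s - 1\<close>, so \<open>k = m q\<close>. Adding a clique vertex costs at most one
  colour, so it suffices that \<open>K\<^sub>l\<^sub>-\<^sub>1 \<or> K\<^sub>a\<^sub>,\<^sub>b\<close> is not \<open>k\<close>-choosable. Fix a \<open>k\<close>-set \<open>X\<close>, partitioned into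
  \<open>m\<close> blocks \<open>P\<^sub>i\<close> of size \<open>q\<close>, and a disjoint \<open>q\<close>-set \<open>Y\<close>. The clique vertices get the list \<open>X\<close>; on the
  side of size \<open>a\<close>, \<open>s\<close> vertices get fresh pairwise disjoint lists, one vertex \<open>w\<close> gets \<open>X\<close>, and \<open>m\<close>
  vertices get the lists \<open>(X - P\<^sub>i) \<union> Y\<close>. The other side carries all lists consisting of a transversal
  of the fresh lists and either \<open>l + 1\<close> elements of \<open>X\<close>, or \<open>l\<close> elements of \<open>X\<close> and one of \<open>Y\<close>. In a
  colouring, the clique and \<open>w\<close> use an \<open>l\<close>-subset \<open>Z\<close> of \<open>X\<close>. If the colour of \<open>w\<close> lies in \<open>P\<^sub>i\<close>, then
  the vertex with list \<open>(X - P\<^sub>i) \<union> Y\<close> has a colour outside \<open>Z\<close>, and together with \<open>Z\<close> and the colours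
  of the \<open>s\<close> vertices it fills a list of the other side.

  The least number \<open>\<tau>\<^sub>s(a,b)\<close> is meaningful only if some clique size makes the difference at most
  \<open>s\<close>; this holds for the clique of size \<open>(a + b)\<^sup>2\<close>, even with difference \<open>0\<close>.
\<close>

subsection \<open>Systems of distinct representatives\<close>

lemma Union_image_Diff: "\<Union>((\<lambda>v. L v - \<Union>(L ` S)) ` T) = \<Union>(L ` (S \<union> T)) - \<Union>(L ` S)"
  by auto

text \<open>Halmos-Vaughan induction. Either a nonempty proper subset \<open>T\<close> is tight, and
  \<open>T\<close> and its complement are matched separately, or every such subset has a spare
  colour, so that an arbitrary choice at one vertex is harmless.\<close>

lemma Hall_marriage:
  assumes "finite V" and "\<And>v. v \<in> V \<Longrightarrow> finite (L v)"
    and "\<And>S. S \<subseteq> V \<Longrightarrow> card S \<le> card (\<Union>(L ` S))"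
  shows "\<exists>c. inj_on c V \<and> (\<forall>v \<in> V. c v \<in> L v)"
  using assms
proof (induction V arbitrary: L rule: finite_psubset_induct)
  case (psubset V)
  note fin = psubset.prems(1) and hall = psubset.prems(2)
  consider "V = {}"
    | T where "T \<subset> V" "T \<noteq> {}" "card (\<Union>(L ` T)) \<le> card T"
    | "V \<noteq> {}" "\<And>T. T \<subset> V \<Longrightarrow> T \<noteq> {} \<Longrightarrow> card T < card (\<Union>(L ` T))"
    using not_le by blast
  then show ?case
  proof cases
    case 1
    then show ?thesis by simp
  next
    case 2
    have finT: "finite T"
      using 2(1) psubset.hyps by (meson finite_subset psubset_imp_subset)
    have "\<exists>c. inj_on c T \<and> (\<forall>v \<in> T. c v \<in> L v)"
      using 2(1) fin hall by (intro psubset.IH) auto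
    then obtain c1 where c1: "inj_on c1 T" "\<And>v. v \<in> T \<Longrightarrow> c1 v \<in> L v"
      by blast
    have "\<exists>c. inj_on c (V - T) \<and> (\<forall>v \<in> V - T. c v \<in> L v - \<Union>(L ` T))"
    proof (rule psubset.IH)
      show "V - T \<subset> V" using 2 by auto
      show "finite (L v - \<Union>(L ` T))" if "v \<in> V - T" for v using fin that by auto
    next
      fix S assume S: "S \<subseteq> V - T"
      have finS: "finite S" using S psubset.hyps by (meson Diff_subset finite_subset)
      \<comment> \<open>Hall's condition for \<open>T \<union> S\<close>, less the tight count for
        \<open>T\<close>, becomes Hall's condition for the lists without the pot of
        \<open>T\<close>.\<close>
      have "card T + card S = card (T \<union> S)"
        using S finT finS by (subst card_Un_disjoint) auto
      also have "\<dots> \<le> card (\<Union>(L ` (T \<union> S)))"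
        using S 2 by (intro hall) auto
      finally have "card S \<le> card (\<Union>(L ` (T \<union> S))) - card (\<Union>(L ` T))"
        using 2(3) by linarith
      also have "\<dots> \<le> card (\<Union>(L ` (T \<union> S)) - \<Union>(L ` T))"
        using finT fin 2(1) by (intro diff_card_le_card_Diff) auto
      finally show "card S \<le> card (\<Union>((\<lambda>v. L v - \<Union>(L ` T)) ` S))"
        by (simp only: Union_image_Diff)
    qed
    then obtain c2 where c2: "inj_on c2 (V - T)" "\<And>v. v \<in> V - T \<Longrightarrow> c2 v \<in> L v - \<Union>(L ` T)"
      by blast
    define c where "c v = (if v \<in> T then c1 v else c2 v)" for v
    have "inj_on c V"
    proof (rule inj_onI)
      fix u v assume uv: "u \<in> V" "v \<in> V" "c u = c v"
      show "u = v"
      proof (cases "u \<in> T"; cases "v \<in> T")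
        assume "u \<in> T" "v \<in> T"
        then show ?thesis using uv c1(1) by (auto simp: c_def inj_on_def)
      next
        assume "u \<notin> T" "v \<notin> T"
        then show ?thesis using uv c2(1) by (auto simp: c_def inj_on_def)
      next
        assume "u \<in> T" "v \<notin> T"
        then show ?thesis using uv c1(2)[of u] c2(2)[of v] by (auto simp: c_def)
      next
        assume "u \<notin> T" "v \<in> T"
        then show ?thesis using uv c1(2)[of v] c2(2)[of u] by (auto simp: c_def)
      qed
    qed
    moreover have "\<forall>v \<in> V. c v \<in> L v" using c1(2) c2(2) by (auto simp: c_def)
    ultimately show ?thesis by blast
  next
    case 3
    then obtain v where v: "v \<in> V" by blast
    have "card {v} \<le> card (\<Union>(L ` {v}))" using v by (intro hall) auto
    then have "L v \<noteq> {}" by auto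
    then obtain x where x: "x \<in> L v" by blast
    have "\<exists>c. inj_on c (V - {v}) \<and> (\<forall>u \<in> V - {v}. c u \<in> L u - {x})"
    proof (rule psubset.IH)
      show "V - {v} \<subset> V" using v by auto
      show "finite (L u - {x})" if "u \<in> V - {v}" for u using fin that by auto
    next
      fix S assume S: "S \<subseteq> V - {v}"
      have eq: "\<Union>((\<lambda>u. L u - {x}) ` S) = \<Union>(L ` S) - {x}" by auto
      show "card S \<le> card (\<Union>((\<lambda>u. L u - {x}) ` S))"
      proof (cases "S = {}")
        case False
        \<comment> \<open>The strict surplus pays for the loss of the single colour
          \<open>x\<close>.\<close>
        then have "card S < card (\<Union>(L ` S))" using S v 3 by (intro 3) auto
        then show ?thesis unfolding eq by (auto simp: card_Diff_singleton_if)
      qed simp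
    qed
    then obtain c where c: "inj_on c (V - {v})" "\<And>u. u \<in> V - {v} \<Longrightarrow> c u \<in> L u - {x}"
      by blast
    have "inj_on (c(v := x)) V"
      using c by (auto simp: inj_on_def)
    moreover have "\<forall>u \<in> V. (c(v := x)) u \<in> L u" using c x by auto
    ultimately show ?thesis by blast
  qed
qed

text \<open>The pot of a nonempty subset contains a full list, which alone has at least
  \<open>card V\<close> colours.\<close>

lemma distinct_representatives_of_large_sets:
  assumes "finite V" and "\<And>v. v \<in> V \<Longrightarrow> finite (L v)" and "\<And>v. v \<in> V \<Longrightarrow> card V \<le> card (L v)"
  shows "\<exists>c. inj_on c V \<and> (\<forall>v \<in> V. c v \<in> L v)"
proof (rule Hall_marriage)
  fix S assume S: "S \<subseteq> V"
  show "card S \<le> card (\<Union>(L ` S))"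
  proof (cases "S = {}")
    case False
    then obtain v where v: "v \<in> S" by blast
    have "card S \<le> card V" using S assms(1) by (simp add: card_mono)
    also have "\<dots> \<le> card (L v)" using v S assms(3) by auto
    also have "\<dots> \<le> card (\<Union>(L ` S))"
      using v S assms finite_subset[OF S] by (intro card_mono) auto
    finally show ?thesis .
  qed simp
qed (use assms in auto)

text \<open>The set \<open>S\<close> is a largest violator of Hall's condition.\<close>

lemma distinct_representatives_outside_small_pot:
  assumes "finite V" and "\<And>v. v \<in> V \<Longrightarrow> finite (L v)"
  obtains S c where "S \<subseteq> V" "S = {} \<or> card (\<Union>(L ` S)) < card S"
    "inj_on c (V - S)" "\<And>v. v \<in> V - S \<Longrightarrow> c v \<in> L v - \<Union>(L ` S)"
proof -
  define F where "F = {S. S \<subseteq> V \<and> (S = {} \<or> card (\<Union>(L ` S)) < card S)}"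
  have "finite F" "F \<noteq> {}" using assms(1) by (auto simp: F_def)
  then obtain S where S: "S \<in> F" and max: "\<And>T. T \<in> F \<Longrightarrow> S \<subseteq> T \<Longrightarrow> S = T"
    using finite_has_maximal[of F] by blast
  have SV: "S \<subseteq> V" and finS: "finite S" using S assms(1) finite_subset by (auto simp: F_def)
  have "\<exists>c. inj_on c (V - S) \<and> (\<forall>v \<in> V - S. c v \<in> L v - \<Union>(L ` S))"
  proof (rule Hall_marriage)
    fix T assume T: "T \<subseteq> V - S"
    show "card T \<le> card (\<Union>((\<lambda>v. L v - \<Union>(L ` S)) ` T))"
    proof (cases "T = {}")
      case False
      have finT: "finite T" using T assms(1) by (meson Diff_subset finite_subset)
      \<comment> \<open>By maximality \<open>S \<union> T\<close> satisfies Hall's inequality, while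
        the pot of \<open>S\<close> has at most \<open>card S\<close> colours; so at least
        \<open>card T\<close> colours lie outside that pot.\<close>
      have "S \<union> T \<notin> F" using max[of "S \<union> T"] False T by auto
      then have "card (S \<union> T) \<le> card (\<Union>(L ` (S \<union> T)))"
        using SV T by (auto simp: F_def)
      moreover have "card (S \<union> T) = card S + card T"
        using T finT finS by (subst card_Un_disjoint) auto
      moreover have "card (\<Union>(L ` S)) \<le> card S" using S by (auto simp: F_def)
      ultimately have "card T \<le> card (\<Union>(L ` (S \<union> T))) - card (\<Union>(L ` S))"
        by linarith
      also have "\<dots> \<le> card (\<Union>(L ` (S \<union> T)) - \<Union>(L ` S))"
        using finS SV assms(2) by (intro diff_card_le_card_Diff) auto
      finally show ?thesis by (simp only: Union_image_Diff)
    qed simp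
  qed (use assms in auto)
  then show ?thesis using S that by (auto simp: F_def)
qed

text \<open>Serves to place every list of a family on a side with \<open>b\<close> vertices; surplus
  vertices repeat one list.\<close>

lemma enumeration_of_card_le:
  assumes "finite F" "F \<noteq> {}" "card F \<le> b"
  obtains g :: "nat \<Rightarrow> 'a" where "g ` {..<b} = F"
proof -
  obtain h where h: "bij_betw h {0..<card F} F" using ex_bij_betw_nat_finite[OF assms(1)] by blast
  have pos: "card F > 0" using assms by (simp add: card_gt_0_iff)
  define g where "g i = (if i < card F then h i else h 0)" for i
  have "h ` {0..<card F} = F" using h by (simp add: bij_betw_def)
  moreover have "g ` {..<b} = h ` {0..<card F}"
    using pos assms(3) by (force simp: g_def image_iff)
  ultimately have "g ` {..<b} = F" by simp
  then show ?thesis by (rule that)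
qed

subsection \<open>Colourings of joins of complete and complete bipartite graphs\<close>

abbreviation clique_join :: "nat \<Rightarrow> nat \<Rightarrow> nat \<Rightarrow> (nat + nat + nat) ugraph" where
  "clique_join n a b \<equiv> join (complete_graph n) (complete_bipartite a b)"

lemma verts_clique_join: "verts (clique_join n a b) = {..<n} <+> ({..<a} <+> {..<b})"
  by (simp add: join_def complete_graph_def complete_bipartite_def)

lemma finite_verts_clique_join [simp]: "finite (verts (clique_join n a b))"
  by (simp add: verts_clique_join)

lemma in_verts_clique_join [simp]:
  "Inl i \<in> verts (clique_join n a b) \<longleftrightarrow> i < n"
  "Inr (Inl u) \<in> verts (clique_join n a b) \<longleftrightarrow> u < a"
  "Inr (Inr v) \<in> verts (clique_join n a b) \<longleftrightarrow> v < b"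
  by (auto simp: verts_clique_join)

lemma edges_clique_join:
  "edges (clique_join n a b) =
     {{Inl i, Inl j} | i j. i < n \<and> j < n \<and> i \<noteq> j}
     \<union> {{Inr (Inl u), Inr (Inr v)} | u v. u < a \<and> v < b}
     \<union> {{Inl i, Inr (Inl u)} | i u. i < n \<and> u < a}
     \<union> {{Inl i, Inr (Inr v)} | i v. i < n \<and> v < b}"
  (is "_ = ?R")
proof
  show "edges (clique_join n a b) \<subseteq> ?R"
    by (auto simp: join_def complete_graph_def complete_bipartite_def)
  have "{Inl i, Inl j} \<in> edges (clique_join n a b)" if "i < n" "j < n" "i \<noteq> j" for i j
  proof -
    have "{i, j} \<in> edges (complete_graph n)" using that by (auto simp: complete_graph_def)
    then have "(Inl ` {i, j} :: (nat + nat + nat) set) \<in> (image Inl) ` edges (complete_graph n)" by (rule imageI)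
    then show ?thesis by (simp add: join_def)
  qed
  moreover have "{Inr (Inl u), Inr (Inr v)} \<in> edges (clique_join n a b)" if "u < a" "v < b" for u v
  proof -
    have "{Inl u, Inr v} \<in> edges (complete_bipartite a b)"
      using that by (auto simp: complete_bipartite_def)
    then have "(Inr ` {Inl u, Inr v} :: (nat + nat + nat) set) \<in> (image Inr) ` edges (complete_bipartite a b)"
      by (rule imageI)
    then show ?thesis by (simp add: join_def)
  qed
  moreover have "{Inl i, Inr w} \<in> edges (clique_join n a b)"
    if "i < n" "w \<in> {..<a} <+> {..<b}" for i w
    using that by (auto simp: join_def complete_graph_def complete_bipartite_def)
  ultimately show "?R \<subseteq> edges (clique_join n a b)" by blast
qed

lemma proper_colouring_clique_join_iff:
  "proper_colouring (clique_join n a b) c \<longleftrightarrow>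
     inj_on (c \<circ> Inl) {..<n}
     \<and> (\<forall>i<n. \<forall>u<a. c (Inl i) \<noteq> c (Inr (Inl u)))
     \<and> (\<forall>i<n. \<forall>v<b. c (Inl i) \<noteq> c (Inr (Inr v)))
     \<and> (\<forall>u<a. \<forall>v<b. c (Inr (Inl u)) \<noteq> c (Inr (Inr v)))"
  (is "?P \<longleftrightarrow> ?Q")
proof
  assume "?P"
  then have P: "c x \<noteq> c y" if "{x, y} \<in> edges (clique_join n a b)" for x y
    using that by (simp add: proper_colouring_def)
  have "c (Inl i) \<noteq> c (Inl j)" if "i < n" "j < n" "i \<noteq> j" for i j
    using that by (intro P) (auto simp: edges_clique_join)
  then have "inj_on (c \<circ> Inl) {..<n}"
    by (auto simp: inj_on_def)
  moreover have "c (Inl i) \<noteq> c (Inr (Inl u))" if "i < n" "u < a" for i u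
    using that by (intro P) (auto simp: edges_clique_join)
  moreover have "c (Inl i) \<noteq> c (Inr (Inr v))" if "i < n" "v < b" for i v
    using that by (intro P) (auto simp: edges_clique_join)
  moreover have "c (Inr (Inl u)) \<noteq> c (Inr (Inr v))" if "u < a" "v < b" for u v
    using that by (intro P) (auto simp: edges_clique_join)
  ultimately show ?Q by simp
next
  assume Q: ?Q
  show ?P unfolding proper_colouring_def
  proof (intro allI impI)
    fix x y assume "{x, y} \<in> edges (clique_join n a b)"
    then consider i j where "{x, y} = {Inl i, Inl j}" "i < n" "j < n" "i \<noteq> j"
      | u v where "{x, y} = {Inr (Inl u), Inr (Inr v)}" "u < a" "v < b"
      | i u where "{x, y} = {Inl i, Inr (Inl u)}" "i < n" "u < a"
      | i v where "{x, y} = {Inl i, Inr (Inr v)}" "i < n" "v < b"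
      unfolding edges_clique_join by blast
    then show "c x \<noteq> c y"
    proof cases
      case 1
      then have "c (Inl i) \<noteq> c (Inl j)" using Q by (auto simp: inj_on_def)
      then show ?thesis using 1(1) by (auto simp: doubleton_eq_iff)
    next
      case 2
      then have "c (Inr (Inl u)) \<noteq> c (Inr (Inr v))" using Q by simp
      then show ?thesis using 2(1) by (auto simp: doubleton_eq_iff)
    next
      case 3
      then have "c (Inl i) \<noteq> c (Inr (Inl u))" using Q by simp
      then show ?thesis using 3(1) by (auto simp: doubleton_eq_iff)
    next
      case 4
      then have "c (Inl i) \<noteq> c (Inr (Inr v))" using Q by simp
      then show ?thesis using 4(1) by (auto simp: doubleton_eq_iff)
    qed
  qed
qed

lemma inj_on_imp_proper_colouring:
  assumes "inj_on c (verts (clique_join n a b))"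
  shows "proper_colouring (clique_join n a b) c"
  using assms unfolding proper_colouring_clique_join_iff
  by (auto simp: inj_on_def verts_clique_join)

lemma chromatic_number_clique_join:
  assumes "a > 0" and "b > 0"
  shows "chromatic_number (clique_join n a b) = n + 2"
  unfolding chromatic_number_def
proof (rule Least_equality)
  define c :: "nat + nat + nat \<Rightarrow> nat" where
    "c = case_sum id (case_sum (\<lambda>_. n) (\<lambda>_. Suc n))"
  have "proper_colouring (clique_join n a b) c"
    by (auto simp: proper_colouring_clique_join_iff c_def inj_on_def)
  moreover have "c ` verts (clique_join n a b) \<subseteq> {..<n + 2}"
    by (auto simp: verts_clique_join c_def)
  ultimately show "colourable (clique_join n a b) (n + 2)"
    unfolding colourable_def by blast
next
  fix k assume "colourable (clique_join n a b) k"
  then obtain c where c: "proper_colouring (clique_join n a b) c"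
    "c ` verts (clique_join n a b) \<subseteq> {..<k}"
    unfolding colourable_def by blast
  \<comment> \<open>The clique and one vertex of each side span a complete graph on
    \<open>n + 2\<close> vertices.\<close>
  define A :: "(nat + nat + nat) set" where "A = Inl ` {..<n} \<union> {Inr (Inl 0), Inr (Inr 0)}"
  have "inj_on c A"
    using c(1) assms unfolding proper_colouring_clique_join_iff A_def
    by (auto simp: inj_on_def) metis+
  then have "card A = card (c ` A)" by (simp add: card_image)
  also have "\<dots> \<le> card {..<k}"
    using c(2) assms by (intro card_mono) (auto simp: A_def image_subset_iff)
  also have "card A = n + 2"
    unfolding A_def by (subst card_Un_disjoint) (auto simp: card_image)
  finally show "n + 2 \<le> k" by simp
qed

subsection \<open>Choosability\<close>

text \<open>\<open>choosable\<close> speaks of lists of size exactly \<open>k\<close>; trimming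
  makes it applicable to larger lists, such as those left after deleting a colour.\<close>

lemma choosableD:
  assumes "choosable G k"
    and "\<And>v. v \<in> verts G \<Longrightarrow> \<exists>M \<subseteq> L v. finite M \<and> card M = k"
  shows "\<exists>c. proper_colouring G c \<and> (\<forall>v \<in> verts G. c v \<in> L v)"
proof -
  obtain M where M: "\<And>v. v \<in> verts G \<Longrightarrow> M v \<subseteq> L v \<and> finite (M v) \<and> card (M v) = k"
    using assms(2) by metis
  then obtain c where "proper_colouring G c" "\<forall>v \<in> verts G. c v \<in> M v"
    using assms(1) unfolding choosable_def by blast
  then show ?thesis using M by blast
qed

lemma choosable_mono:
  assumes "choosable G k" and "k \<le> k'"
  shows "choosable G k'"
  unfolding choosable_def
proof (intro allI impI)
  fix L :: "'a \<Rightarrow> nat set"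
  assume L: "\<forall>v \<in> verts G. finite (L v) \<and> card (L v) = k'"
  show "\<exists>c. proper_colouring G c \<and> (\<forall>v \<in> verts G. c v \<in> L v)"
    by (rule choosableD[OF assms(1)]) (metis L assms(2) obtain_subset_with_card_n)
qed

text \<open>Lists this long allow pairwise distinct colours. This supplies the witness for
  \<open>LEAST\<close> in \<open>list_chromatic_number\<close>.\<close>

lemma choosable_card_verts: "choosable (clique_join n a b) (card (verts (clique_join n a b)))"
  unfolding choosable_def
proof (intro allI impI)
  let ?V = "verts (clique_join n a b)"
  fix L :: "nat + nat + nat \<Rightarrow> nat set"
  assume "\<forall>v \<in> ?V. finite (L v) \<and> card (L v) = card ?V"
  then have "\<exists>c. inj_on c ?V \<and> (\<forall>v \<in> ?V. c v \<in> L v)"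
    by (intro distinct_representatives_of_large_sets) auto
  then show "\<exists>c. proper_colouring (clique_join n a b) c \<and> (\<forall>v \<in> ?V. c v \<in> L v)"
    using inj_on_imp_proper_colouring by blast
qed

lemma less_list_chromatic_number_iff:
  "k < list_chromatic_number (clique_join n a b) \<longleftrightarrow> \<not> choosable (clique_join n a b) k"
proof
  show "k < list_chromatic_number (clique_join n a b) \<Longrightarrow> \<not> choosable (clique_join n a b) k"
    unfolding list_chromatic_number_def by (rule not_less_Least)
next
  assume "\<not> choosable (clique_join n a b) k"
  moreover have "choosable (clique_join n a b) (list_chromatic_number (clique_join n a b))"
    unfolding list_chromatic_number_def using choosable_card_verts by (rule LeastI)
  ultimately show "k < list_chromatic_number (clique_join n a b)"
    using choosable_mono not_less by blast
qed

text \<open>The new vertex \<open>Inl n\<close> takes any colour \<open>x\<close> of its list;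
  deleting \<open>x\<close> elsewhere leaves at least \<open>k\<close> colours per list.\<close>

lemma choosable_clique_join_Suc:
  assumes "choosable (clique_join n a b) k"
  shows "choosable (clique_join (Suc n) a b) (Suc k)"
  unfolding choosable_def
proof (intro allI impI)
  let ?V = "verts (clique_join (Suc n) a b)"
  fix L :: "nat + nat + nat \<Rightarrow> nat set"
  assume L: "\<forall>v \<in> ?V. finite (L v) \<and> card (L v) = Suc k"
  then have "card (L (Inl n)) = Suc k" by auto
  then obtain x where x: "x \<in> L (Inl n)" by fastforce
  have V: "v \<in> ?V" if "v \<in> verts (clique_join n a b)" for v
    using that by (auto simp: verts_clique_join)
  have "\<exists>c. proper_colouring (clique_join n a b) c
      \<and> (\<forall>v \<in> verts (clique_join n a b). c v \<in> L v - {x})"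
  proof (rule choosableD[OF assms])
    fix v assume "v \<in> verts (clique_join n a b)"
    then have "k \<le> card (L v - {x})"
      using L V by (metis card_Diff1_le card_Diff_singleton_if diff_Suc_1 le_SucI order_refl)
    then show "\<exists>M \<subseteq> L v - {x}. finite M \<and> card M = k"
      by (metis obtain_subset_with_card_n)
  qed
  then obtain c where c: "proper_colouring (clique_join n a b) c"
    "\<And>v. v \<in> verts (clique_join n a b) \<Longrightarrow> c v \<in> L v - {x}" by blast
  have "c (Inl i) \<noteq> x" if "i < n" for i using c(2)[of "Inl i"] that by auto
  moreover have "c (Inr (Inl u)) \<noteq> x" if "u < a" for u using c(2)[of "Inr (Inl u)"] that by auto
  moreover have "c (Inr (Inr v)) \<noteq> x" if "v < b" for v using c(2)[of "Inr (Inr v)"] that by auto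
  ultimately have "proper_colouring (clique_join (Suc n) a b) (c(Inl n := x))"
    using c(1) unfolding proper_colouring_clique_join_iff
    by (auto simp: inj_on_def less_Suc_eq) blast+
  moreover have "(c(Inl n := x)) v \<in> L v" if "v \<in> ?V" for v
  proof (cases "v = Inl n")
    case False
    then have "v \<in> verts (clique_join n a b)"
      using that by (auto simp: verts_clique_join less_Suc_eq)
    then show ?thesis using False c(2) by auto
  qed (use x in simp)
  ultimately show "\<exists>c. proper_colouring (clique_join (Suc n) a b) c \<and> (\<forall>v \<in> ?V. c v \<in> L v)"
    by blast
qed

lemma choosable_clique_join_add:
  assumes "choosable (clique_join n a b) k"
  shows "choosable (clique_join (n + d) a b) (k + d)"
  using assms by (induction d) (auto intro: choosable_clique_join_Suc)

text \<open>A violator \<open>S\<close> of Hall's condition has a pot of fewer than \<open>|V|\<close> colours, so each list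
  misses fewer than \<open>a + b\<close> colours of the pot. As the clique is large, two colours are common to
  all vertices of the bipartite part of \<open>S\<close>, and one is used for each side.\<close>

lemma choosable_large_clique_join:
  "choosable (clique_join ((a + b) * (a + b)) a b) ((a + b) * (a + b) + 2)"
  unfolding choosable_def
proof (intro allI impI)
  define N where "N = (a + b) * (a + b)"
  let ?G = "clique_join ((a + b) * (a + b)) a b"
  define V where "V = verts ?G"
  fix L :: "nat + nat + nat \<Rightarrow> nat set"
  assume "\<forall>v \<in> verts ?G. finite (L v) \<and> card (L v) = (a + b) * (a + b) + 2"
  then have L: "\<And>v. v \<in> V \<Longrightarrow> finite (L v)" "\<And>v. v \<in> V \<Longrightarrow> card (L v) = N + 2"
    by (auto simp: N_def V_def)
  have finV: "finite V" and cardV: "card V = N + (a + b)"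
    by (simp_all add: V_def N_def verts_clique_join card_Plus)
  obtain S c0 where S: "S \<subseteq> V" "S = {} \<or> card (\<Union>(L ` S)) < card S"
    and c0: "inj_on c0 (V - S)" "\<And>v. v \<in> V - S \<Longrightarrow> c0 v \<in> L v - \<Union>(L ` S)"
    using distinct_representatives_outside_small_pot[of V L] finV L(1) by metis
  show "\<exists>c. proper_colouring ?G c \<and> (\<forall>v \<in> verts ?G. c v \<in> L v)"
  proof (cases "S = {}")
    case True
    then have "inj_on c0 (verts ?G)" "\<forall>v \<in> verts ?G. c0 v \<in> L v"
      using c0 by (simp_all add: V_def)
    then show ?thesis using inj_on_imp_proper_colouring by blast
  next
    case False
    define P where "P = \<Union>(L ` S)"
    define D where "D = S \<inter> range Inr"
    define Q where "Q = P - (\<Union>v\<in>D. P - L v)"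
    have finS: "finite S" using S(1) finV finite_subset by blast
    then have finP: "finite P" using S(1) L(1) by (auto simp: P_def)
    have finD: "finite D" using finS by (simp add: D_def)
    have D_sub: "D \<subseteq> Inr ` ({..<a} <+> {..<b})"
      using S(1) by (auto simp: D_def V_def verts_clique_join)
    have cardD: "card D \<le> a + b"
    proof -
      have "card D \<le> card (Inr ` ({..<a} <+> {..<b}) :: (nat + nat + nat) set)"
        by (intro card_mono D_sub) simp
      also have "\<dots> = a + b" by (simp add: card_image card_Plus)
      finally show ?thesis .
    qed
    have "card P < card S" using S(2) False by (simp add: P_def)
    also have "card S \<le> card V" using S(1) finV by (simp add: card_mono)
    finally have P_less: "card P < N + (a + b)" using cardV by simp
    obtain w where w: "w \<in> S" using False by blast
    have "card (L w) \<le> card P" using w finP by (intro card_mono) (auto simp: P_def)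
    then have P_ge: "N + 2 \<le> card P" using L(2) w S(1) by auto
    have miss: "card (P - L v) \<le> a + b" if "v \<in> D" for v
    proof -
      have v: "v \<in> S" "v \<in> V" using that S(1) by (auto simp: D_def)
      then have "card (P - L v) = card P - card (L v)"
        using L(1) by (intro card_Diff_subset) (auto simp: P_def)
      then show ?thesis using P_less L(2) v by simp
    qed
    \<comment> \<open>At most \<open>a + b\<close> vertices each exclude at most
      \<open>a + b\<close> colours, which is why \<open>N\<close> is the square of
      \<open>a + b\<close>. The pot has at least \<open>N + 2\<close> colours, so two survive in
      \<open>Q\<close>.\<close>
    have "card (\<Union>v\<in>D. P - L v) \<le> (\<Sum>v\<in>D. card (P - L v))"
      by (rule card_UN_le[OF finD])
    also have "\<dots> \<le> card D * (a + b)"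
      using sum_bounded_above[of D "\<lambda>v. card (P - L v)" "a + b"] miss by simp
    also have "\<dots> \<le> N" using cardD by (simp add: N_def)
    finally have "card (\<Union>v\<in>D. P - L v) \<le> N" .
    moreover have "card P - card (\<Union>v\<in>D. P - L v) \<le> card Q"
      unfolding Q_def using finD finP by (intro diff_card_le_card_Diff) auto
    ultimately have "2 \<le> card Q" using P_ge by linarith
    then obtain x y where xy: "x \<in> Q" "y \<in> Q" "x \<noteq> y"
      by (metis obtain_subset_with_card_n card_2_iff insert_subset)
    have xy_P: "x \<in> P" "y \<in> P" using xy by (auto simp: Q_def)
    have xy_L: "x \<in> L v" "y \<in> L v" if "v \<in> D" for v
      using xy that by (auto simp: Q_def)
    define C where "C = S \<inter> range Inl"
    have "C \<subseteq> Inl ` {..<N}"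
      using S(1) by (auto simp: C_def V_def verts_clique_join N_def)
    then have "card C \<le> card (Inl ` {..<N} :: (nat + nat + nat) set)"
      by (intro card_mono) auto
    then have cardC: "card C \<le> N" by (simp add: card_image)
    have CV: "C \<subseteq> V" using S(1) by (auto simp: C_def)
    \<comment> \<open>With \<open>x\<close> and \<open>y\<close> reserved for the two sides, each
      list still has at least \<open>N\<close> colours for the at most \<open>N\<close> clique
      vertices in \<open>S\<close>.\<close>
    have "\<exists>c. inj_on c C \<and> (\<forall>v \<in> C. c v \<in> L v - {x, y})"
    proof (rule distinct_representatives_of_large_sets)
      show "finite C" using finS by (simp add: C_def)
      show "finite (L v - {x, y})" if "v \<in> C" for v using that CV L(1) by auto
      show "card C \<le> card (L v - {x, y})" if "v \<in> C" for v
      proof -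
        have "card (L v) - card {x, y} \<le> card (L v - {x, y})"
          by (intro diff_card_le_card_Diff) auto
        moreover have "card (L v) = N + 2" using that CV L(2) by auto
        ultimately show ?thesis using cardC xy(3) by simp
      qed
    qed
    then obtain c1 where c1: "inj_on c1 C" "\<And>v. v \<in> C \<Longrightarrow> c1 v \<in> L v - {x, y}" by blast
    define c where "c v = (if v \<notin> S then c0 v else
      case v of Inl _ \<Rightarrow> c1 v | Inr (Inl _) \<Rightarrow> x | Inr (Inr _) \<Rightarrow> y)" for v
    have c_in: "c v \<in> L v" if "v \<in> V" for v
    proof (cases "v \<in> S")
      case True
      then show ?thesis
        using c1(2)[of v] xy_L[of v] by (auto simp: c_def C_def D_def split: sum.split)
    next
      case False
      then show ?thesis using that c0(2) by (simp add: c_def)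
    qed
    have c_S: "c v \<in> P" if "v \<in> S" for v
      using c_in that S(1) by (auto simp: P_def)
    have c_notS: "c v \<notin> P" "c v = c0 v" if "v \<in> V - S" for v
      using c0(2)[OF that] that by (auto simp: c_def P_def)
    \<comment> \<open>Colours inside \<open>S\<close> lie in \<open>P\<close>; those outside are
      distinct and avoid \<open>P\<close>. Only pairs within \<open>S\<close> remain to be
      checked.\<close>
    have neq: "c u \<noteq> c v"
      if "u \<in> V" "v \<in> V" "u \<noteq> v" "u \<in> S \<Longrightarrow> v \<in> S \<Longrightarrow> c u \<noteq> c v" for u v
    proof (cases "u \<in> S"; cases "v \<in> S")
      assume "u \<notin> S" "v \<notin> S"
      then show ?thesis using that c0(1) c_notS(2) by (auto simp: inj_on_def)
    qed (use that c_S c_notS in \<open>auto, metis+\<close>)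
    have "proper_colouring ?G c"
      unfolding proper_colouring_clique_join_iff
    proof (intro conjI allI impI)
      show "inj_on (c \<circ> Inl) {..<(a + b) * (a + b)}"
      proof (rule inj_onI, rule ccontr)
        fix i j assume ij: "i \<in> {..<(a + b) * (a + b)}" "j \<in> {..<(a + b) * (a + b)}"
          "(c \<circ> Inl) i = (c \<circ> Inl) j" "i \<noteq> j"
        have "c (Inl i) \<noteq> c (Inl j)"
        proof (rule neq)
          assume "Inl i \<in> S" "Inl j \<in> S"
          then show "c (Inl i) \<noteq> c (Inl j)"
            using ij(4) c1(1) by (auto simp: c_def C_def inj_on_def)
        qed (use ij in \<open>auto simp: V_def\<close>)
        then show False using ij by simp
      qed
    next
      fix i u assume "i < (a + b) * (a + b)" "u < a"
      then show "c (Inl i) \<noteq> c (Inr (Inl u))"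
        using c1(2)[of "Inl i"] by - (rule neq, auto simp: V_def c_def C_def)
    next
      fix i v assume "i < (a + b) * (a + b)" "v < b"
      then show "c (Inl i) \<noteq> c (Inr (Inr v))"
        using c1(2)[of "Inl i"] by - (rule neq, auto simp: V_def c_def C_def)
    next
      fix u v assume "u < a" "v < b"
      then show "c (Inr (Inl u)) \<noteq> c (Inr (Inr v))"
        using xy(3) by - (rule neq, auto simp: V_def c_def)
    qed
    then show ?thesis using c_in unfolding V_def by blast
  qed
qed

subsection \<open>Lists without a colouring\<close>

text \<open>The side of size \<open>a\<close> appears as \<open>s + 1 + m\<close>: \<open>s\<close>
  fresh lists, one list \<open>X\<close>, and \<open>m\<close> lists that trade a block of
  \<open>X\<close> for \<open>Y\<close>.\<close>

lemma not_choosable_clique_join: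
  fixes s l m q k b :: nat
  assumes l: "l \<ge> 1" and k: "k = l + s + 1" and mq: "m * q = k"
    and b: "b \<ge> k ^ s * ((k choose (l + 1)) + (k choose l) * q)"
  shows "\<not> choosable (clique_join (l - 1) (s + 1 + m) b) k"
proof
  assume ch: "choosable (clique_join (l - 1) (s + 1 + m) b) k"
  let ?G = "clique_join (l - 1) (s + 1 + m) b"
  \<comment> \<open>The palette is laid out in consecutive intervals: \<open>X\<close>, then
    \<open>Y\<close>, then \<open>s\<close> fresh blocks of length \<open>k\<close>, the
    \<open>j\<close>-th starting at \<open>base j\<close>. For \<open>t\<close> with values below
    \<open>k\<close>, \<open>T t\<close> takes one colour from each fresh block.\<close>
  define X where "X = {..<k}"
  define Y where "Y = {k..<k + q}"
  define P where "P i = {i * q..<i * q + q}" for i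
  define base where "base j = k + q + j * k" for j
  define T where "T t = (\<lambda>j. base j + t j) ` {..<s}" for t
  define U1 where "U1 = {U. U \<subseteq> X \<and> card U = l + 1}"
  define U2 where "U2 = (\<lambda>(Z, y). insert y Z) ` ({Z. Z \<subseteq> X \<and> card Z = l} \<times> Y)"
  \<comment> \<open>There are \<open>k ^ s\<close> choices of \<open>t\<close>, and the number of
    sets \<open>U\<close> is at most the other factor in the bound on \<open>b\<close>. Each member
    has \<open>s + (l + 1) = k\<close> colours.\<close>
  define F where "F = (\<lambda>(t, U). T t \<union> U) ` (({..<s} \<rightarrow>\<^sub>E {..<k}) \<times> (U1 \<union> U2))"
  have q: "q > 0" using mq k by (cases q) auto
  have finX: "finite X" by (simp add: X_def)
  have fin1: "finite U1" using finX by (simp add: U1_def)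
  have fin2: "finite ({Z. Z \<subseteq> X \<and> card Z = l} \<times> Y)" using finX by (simp add: Y_def)
  have finF: "finite F"
    unfolding F_def using fin1 fin2
    by (intro finite_imageI finite_cartesian_product finite_PiE) (auto simp: U2_def)
  have "card U1 = k choose (l + 1)"
    unfolding U1_def using n_subsets[OF finX] by (simp add: X_def)
  moreover have "card U2 \<le> (k choose l) * q"
  proof -
    have "card U2 \<le> card ({Z. Z \<subseteq> X \<and> card Z = l} \<times> Y)"
      unfolding U2_def by (rule card_image_le[OF fin2])
    also have "\<dots> = (k choose l) * q"
      using n_subsets[OF finX, of l] by (simp add: card_cartesian_product X_def Y_def)
    finally show ?thesis .
  qed
  ultimately have cardU: "card (U1 \<union> U2) \<le> (k choose (l + 1)) + (k choose l) * q"
    using card_Un_le[of U1 U2] by linarith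
  have "card F \<le> card (({..<s} \<rightarrow>\<^sub>E {..<k}) \<times> (U1 \<union> U2))"
    unfolding F_def using fin1 fin2
    by (intro card_image_le finite_cartesian_product finite_PiE) (auto simp: U2_def)
  also have "\<dots> = k ^ s * card (U1 \<union> U2)"
    by (simp add: card_cartesian_product card_PiE)
  also have "\<dots> \<le> k ^ s * ((k choose (l + 1)) + (k choose l) * q)"
    using cardU by (intro mult_left_mono) auto
  finally have cardF: "card F \<le> b" using b by linarith
  have "{..<l + 1} \<in> U1" using k by (auto simp: U1_def X_def)
  moreover have "(\<lambda>j\<in>{..<s}. 0) \<in> {..<s} \<rightarrow>\<^sub>E {..<k}" using k by auto
  ultimately have "F \<noteq> {}" unfolding F_def by blast
  then obtain g where g: "g ` {..<b} = F" using enumeration_of_card_le finF cardF by metis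
  have cardW: "finite W \<and> card W = k" if "W \<in> F" for W
  proof -
    from that obtain t U where W: "W = T t \<union> U" "t \<in> {..<s} \<rightarrow>\<^sub>E {..<k}" "U \<in> U1 \<union> U2"
      unfolding F_def by auto
    have U: "finite U \<and> U \<subseteq> {..<k + q} \<and> card U = l + 1"
      using W(3)
    proof
      assume "U \<in> U1"
      then show ?thesis using finite_subset[OF _ finX] by (auto simp: U1_def X_def)
    next
      assume "U \<in> U2"
      then obtain Z y where Z: "U = insert y Z" "Z \<subseteq> X" "card Z = l" "y \<in> Y"
        by (auto simp: U2_def)
      have "finite Z" using Z(2) finX by (rule finite_subset)
      moreover have "y \<notin> Z" using Z by (auto simp: X_def Y_def)
      ultimately show ?thesis using Z by (auto simp: X_def Y_def)
    qed
    have "inj_on (\<lambda>j. base j + t j) {..<s}"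
    proof (rule inj_onI)
      fix i j assume ij: "i \<in> {..<s}" "j \<in> {..<s}" "base i + t i = base j + t j"
      then have lt: "t i < k" "t j < k" using W(2) by auto
      have "i * k + t i = j * k + t j" using ij(3) by (simp add: base_def)
      \<comment> \<open>Division by \<open>k\<close> recovers the index of the fresh block.\<close>
      then have "(i * k + t i) div k = (j * k + t j) div k" by simp
      then show "i = j" using lt by simp
    qed
    then have "card (T t) = s" by (simp add: T_def card_image)
    moreover have "T t \<inter> U = {}" using U by (force simp: T_def base_def)
    moreover have "finite (T t)" by (simp add: T_def)
    ultimately show ?thesis using U W(1) k by (simp add: card_Un_disjoint)
  qed
  define LA where "LA u = (if u < s then {base u..<base u + k} else if u = s then X
    else (X - P (u - s - 1)) \<union> Y)" for u
  have cardLA: "finite (LA u) \<and> card (LA u) = k" if "u < s + 1 + m" for u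
  proof (cases "u \<le> s")
    case False
    then have "u - s - 1 < m" using that by simp
    then have "Suc (u - s - 1) * q \<le> m * q" by (intro mult_right_mono) auto
    then have Pi: "(u - s - 1) * q + q \<le> k" using mq by simp
    then have "P (u - s - 1) \<subseteq> X" by (auto simp: P_def X_def)
    then have "card (X - P (u - s - 1)) = k - q"
      by (simp add: card_Diff_subset P_def X_def)
    moreover have "(X - P (u - s - 1)) \<inter> Y = {}" by (auto simp: X_def Y_def)
    ultimately have "card ((X - P (u - s - 1)) \<union> Y) = (k - q) + q"
      by (subst card_Un_disjoint) (auto simp: X_def Y_def)
    then show ?thesis using False Pi by (auto simp: LA_def X_def Y_def)
  qed (auto simp: LA_def X_def)
  define L :: "nat + nat + nat \<Rightarrow> nat set" where "L = case_sum (\<lambda>_. X) (case_sum LA g)"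
  have "\<forall>v \<in> verts ?G. finite (L v) \<and> card (L v) = k"
    using cardLA cardW g by (auto simp: verts_clique_join L_def X_def)
  then obtain c where c: "proper_colouring ?G c" and cL: "\<And>v. v \<in> verts ?G \<Longrightarrow> c v \<in> L v"
    using ch unfolding choosable_def by blast
  define A where "A u = c (Inr (Inl u))" for u
  define C where "C = (c \<circ> Inl) ` {..<l - 1}"
  have inj: "inj_on (c \<circ> Inl) {..<l - 1}"
    and neq: "\<And>i u. i < l - 1 \<Longrightarrow> u < s + 1 + m \<Longrightarrow> c (Inl i) \<noteq> A u"
      "\<And>i v. i < l - 1 \<Longrightarrow> v < b \<Longrightarrow> c (Inl i) \<noteq> c (Inr (Inr v))"
      "\<And>u v. u < s + 1 + m \<Longrightarrow> v < b \<Longrightarrow> A u \<noteq> c (Inr (Inr v))"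
    using c unfolding proper_colouring_clique_join_iff A_def by blast+
  have A_L: "A u \<in> LA u" if "u < s + 1 + m" for u
    using cL[of "Inr (Inl u)"] that by (simp add: A_def L_def)
  have A_C: "A u \<notin> C" if "u < s + 1 + m" for u
    using neq(1)[OF _ that] by (force simp: C_def)
  have C: "card C = l - 1" "C \<subseteq> X" "finite C"
  proof -
    show "card C = l - 1" unfolding C_def using inj by (subst card_image) auto
    have "c (Inl i) \<in> X" if "i < l - 1" for i
      using cL[of "Inl i"] that by (simp add: L_def)
    then show "C \<subseteq> X" by (auto simp: C_def)
  qed (simp add: C_def)
  \<comment> \<open>The contradiction to aim for: if all of \<open>U\<close> is used by the clique
    and the first side, some vertex of the other side has a list consisting of used colours
    only.\<close>
  have blocked: False if "U \<in> U1 \<union> U2" "U \<subseteq> C \<union> A ` {..<s + 1 + m}" for U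
  proof -
    \<comment> \<open>Reads off the offsets of the colours chosen in the fresh blocks, so that
      \<open>T t\<close> is exactly the set of these colours.\<close>
    define t where "t = (\<lambda>j\<in>{..<s}. A j - base j)"
    have A_j: "base j \<le> A j \<and> A j < base j + k" if "j < s" for j
      using A_L[of j] that by (simp add: LA_def)
    have "A j - base j < k" if "j < s" for j
      using A_j[OF that] by linarith
    then have "t \<in> {..<s} \<rightarrow>\<^sub>E {..<k}" by (auto simp: t_def)
    then have "T t \<union> U \<in> F" using that(1) unfolding F_def by blast
    then obtain v where v: "v < b" "g v = T t \<union> U" using g by force
    have "T t = A ` {..<s}"
      unfolding T_def using A_j by (intro image_cong) (auto simp: t_def)
    moreover have "c (Inr (Inr v)) \<in> T t \<union> U" using cL[of "Inr (Inr v)"] v by (simp add: L_def)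
    ultimately have "c (Inr (Inr v)) \<in> C \<union> A ` {..<s + 1 + m}" using that(2) by auto
    then show False using neq(2,3)[OF _ v(1)] by (force simp: C_def)
  qed
  have x: "A s \<in> X" using A_L[of s] by (simp add: LA_def)
  \<comment> \<open>The blocks \<open>P i\<close> are consecutive intervals of length
    \<open>q\<close>, so division by \<open>q\<close> finds the block containing
    \<open>A s\<close>.\<close>
  define i where "i = A s div q"
  have "A s < m * q" using x mq by (simp add: X_def)
  then have i: "i < m" unfolding i_def by (rule less_mult_imp_div_less)
  have "i * q \<le> A s" "A s < i * q + q"
    using div_mult_mod_eq[of "A s" q] mod_less_divisor[OF q, of "A s"]
    unfolding i_def by linarith+
  then have x_P: "A s \<in> P i" by (simp add: P_def)
  define z where "z = A (s + 1 + i)"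
  have z: "z \<in> (X - P i) \<union> Y" using A_L[of "s + 1 + i"] i by (simp add: LA_def z_def)
  have z_C: "z \<notin> C" using A_C[of "s + 1 + i"] i by (simp add: z_def)
  \<comment> \<open>The list of \<open>z\<close> lacks the block \<open>P i\<close> containing
    \<open>A s\<close>, and \<open>Y\<close> is disjoint from \<open>X\<close>; hence
    \<open>z\<close> is a new colour.\<close>
  have "A s \<notin> Y" using x by (auto simp: X_def Y_def)
  then have z_x: "z \<noteq> A s" using z x_P by auto
  define Z where "Z = insert (A s) C"
  have Z: "card Z = l" "Z \<subseteq> X" "finite Z"
    using A_C[of s] C x l by (auto simp: Z_def)
  have "insert z Z \<in> U1 \<union> U2"
  proof (cases "z \<in> Y")
    case True
    then show ?thesis using Z unfolding U2_def by force
  next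
    case False
    then have "z \<in> X" using z by auto
    moreover have "z \<notin> Z" using z_C z_x by (simp add: Z_def)
    ultimately show ?thesis using Z by (simp add: U1_def)
  qed
  moreover have "insert z Z \<subseteq> C \<union> A ` {..<s + 1 + m}"
    using i by (auto simp: Z_def z_def)
  ultimately show False by (rule blocked)
qed

section \<open>From non-choosability to the bound on \<open>tau\<close>\<close>

theorem theorem8:
  fixes s l a b q :: nat
  assumes "l \<ge> 2"
    and "a > s + 2"
    and "(a - s - 1) dvd (l + s + 1)"
    and "q = (l + s + 1) div (a - s - 1)"
    and "b \<ge> a"
    and "b \<ge> (l + s + 1) ^ s * (((l + s + 1) choose (l + 1)) + ((l + s + 1) choose l) * q)"
  shows "tau s a b \<ge> l"
proof -
  have pos: "a > 0" "b > 0" using assms by auto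
  \<comment> \<open>As the chromatic number is \<open>n + 2\<close>, a difference of at most
    \<open>s\<close> means choosability from lists of size \<open>n + 2 + s\<close>.\<close>
  define good where "good n \<longleftrightarrow> choosable (clique_join n a b) (n + 2 + s)" for n
  have good: "int (list_chromatic_number (clique_join n a b))
      - int (chromatic_number (clique_join n a b)) \<le> int s \<longleftrightarrow> good n" for n
    unfolding good_def chromatic_number_clique_join[OF pos]
    using less_list_chromatic_number_iff[of "n + 2 + s" n a b] by linarith
  have tau: "tau s a b = (LEAST n. good n)" unfolding tau_def good ..
  \<comment> \<open>Some clique size is good, so the \<open>LEAST\<close> defining
    \<open>tau\<close> is attained.\<close>
  have "good ((a + b) * (a + b))"
    unfolding good_def by (rule choosable_mono[OF choosable_large_clique_join]) simp
  then have "good (tau s a b)" unfolding tau by (rule LeastI)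
  then have ch: "choosable (clique_join (tau s a b) a b) (tau s a b + 2 + s)"
    by (simp add: good_def)
  show ?thesis
  proof (rule ccontr)
    assume "\<not> l \<le> tau s a b"
    \<comment> \<open>If \<open>tau s a b < l\<close>, adding \<open>d\<close> clique vertices
      reaches size \<open>l - 1\<close>, and the list size grows with it to
      \<open>(l - 1) + 2 + s = l + s + 1\<close>.\<close>
    moreover define d where "d = l - 1 - tau s a b"
    ultimately have d: "l - 1 = tau s a b + d" "l + s + 1 = tau s a b + 2 + s + d"
      by linarith+
    have "choosable (clique_join (l - 1) a b) (l + s + 1)"
      unfolding d using ch by (rule choosable_clique_join_add)
    moreover have "\<not> choosable (clique_join (l - 1) (s + 1 + (a - s - 1)) b) (l + s + 1)"
      using assms by (intro not_choosable_clique_join[where q = q]) auto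
    ultimately show False using assms(2) by simp
  qed
qed

end
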